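(* Let $G=(V,E)$ be a finite simple graph with $|V|=n$, let $S\subseteq V$, and let $G'=G-S$ be the induced subgraph on $V\setminus S$. Then $$P_G(x)=P_{G'}(x)-R_S(x)+U_S(x),$$ where $$U_S(x)=\sum_{\substack{I\in\mathcal I(G)\\ I\cap S\ne\varnothing}} w_G(I)\,x^{|I|},\qquad R_S(x)=\sum_{I\in\mathcal I(G')}\bigl(w_{G'}(I)-w_G(I)\bigr)x^{|I|}.$$ Moreover: (i) $\mathcal I(G')=\{I\in\mathcal I(G): I\cap S=\varnothing\}$; (ii) for every $I\in\mathcal I(G')$, $|N_{G'}[I]|=|N_G[I]|-|N_G[I]\cap S|$, and consequently $a_{G'}(I)=a_G(I)-\bigl(|S|-|N_G[I]\cap S|\bigr)$; (iii) setting $\Delta b_I=b_{G'}(I)-b_G(I)$ for $I\in\mathcal I(G')$ (so $\Delta b_\varnothing=0$), for every nonempty $I\in\mathcal I(G')$, $$|N_{G'}[I]|\,\Delta b_I=\sum_{v\in I}\Delta b_{I\setminus\{v\}}+|N_G[I]\cap S|\,b_G(I),$$ and in particular the values $\Delta b_I$ are uniquely determined by induction on $|I|$.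
   Context: For a finite graph $H$ with vertex set $W$, $|W|=m$: $\mathcal I(H)$ is the family of independent sets (sets with no two adjacent vertices, including $\varnothing$); for $I\subseteq W$, $N_H(I)$ is the set of vertices adjacent in $H$ to some vertex of $I$, $N_H[I]=I\cup N_H(I)$, and $a_H(I)=|W\setminus N_H[I]|$. Define $b_H$ on $\mathcal I(H)$ by $b_H(\varnothing)=1$ and $b_H(I)=\frac{1}{m-a_H(I)}\sum_{v\in I}b_H(I\setminus\{v\})=\frac{1}{|N_H[I]|}\sum_{v\in I}b_H(I\setminus\{v\})$ for $I\ne\varnothing$; set $w_H(I)=\frac{a_H(I)}{m}b_H(I)$ and $P_H(x)=\sum_{I\in\mathcal I(H)}w_H(I)x^{|I|}$ (the successive ordering polynomial of $H$). These are applied with $H=G$ ($m=n$) and $H=G'$ ($m=n-|S|$). *)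

theory Defs
  imports "HOL-Computational_Algebra.Polynomial" "Graph_Theory.Digraph_Component"
begin

text \<open>
  Finite simple graphs are those satisfying the locale predicate \<^const>\<open>graph\<close>: finite, loop-free,
  without parallel arcs and symmetric, each undirected edge being a pair of opposite arcs.
\<close>

definition independent_sets :: "('a, 'b) pre_digraph \<Rightarrow> 'a set set" where
  "independent_sets H = {I. I \<subseteq> verts H \<and> (\<forall>u\<in>I. \<forall>v\<in>I. \<not> u \<rightarrow>\<^bsub>H\<^esub> v)}"

definition nbhd :: "('a, 'b) pre_digraph \<Rightarrow> 'a set \<Rightarrow> 'a set" where
  "nbhd H I = {v \<in> verts H. \<exists>u\<in>I. u \<rightarrow>\<^bsub>H\<^esub> v}"

definition closed_nbhd :: "('a, 'b) pre_digraph \<Rightarrow> 'a set \<Rightarrow> 'a set" where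
  "closed_nbhd H I = I \<union> nbhd H I"

definition a_num :: "('a, 'b) pre_digraph \<Rightarrow> 'a set \<Rightarrow> nat" where
  "a_num H I = card (verts H - closed_nbhd H I)"

text \<open>Only the values on \<^const>\<open>independent_sets\<close> matter; 0 on infinite sets ensures termination.\<close>

function b_coeff :: "('a, 'b) pre_digraph \<Rightarrow> 'a set \<Rightarrow> real" where
  "b_coeff H I =
    (if I = {} then 1
     else if finite I then
       1 / (real (card (verts H)) - real (a_num H I)) * (\<Sum>v\<in>I. b_coeff H (I - {v}))
     else 0)"
  by auto
termination
  by (relation "measure (\<lambda>(H, I). card I)") (auto simp: card_gt_0_iff)

declare b_coeff.simps [simp del]

lemma b_coeff_empty: "b_coeff H {} = 1"
  by (simp add: b_coeff.simps)

lemma b_coeff_closed_nbhd: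
  assumes "finite (verts H)" "I \<subseteq> verts H" "I \<noteq> {}"
  shows "b_coeff H I = 1 / real (card (closed_nbhd H I)) * (\<Sum>v\<in>I. b_coeff H (I - {v}))"
proof -
  have sub: "closed_nbhd H I \<subseteq> verts H"
    using assms(2) by (auto simp: closed_nbhd_def nbhd_def)
  have "finite I" and "finite (closed_nbhd H I)"
    using assms sub finite_subset by blast+
  moreover have "card (closed_nbhd H I) \<le> card (verts H)"
    using assms(1) sub by (rule card_mono)
  ultimately show ?thesis
    using assms(3) sub
    by (subst b_coeff.simps) (simp add: a_num_def card_Diff_subset of_nat_diff)
qed

text \<open>
  On the graph without vertices the quotient below is 0 / 0, which is 0 in HOL.
\<close>

definition w_coeff :: "('a, 'b) pre_digraph \<Rightarrow> 'a set \<Rightarrow> real" where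
  "w_coeff H I = real (a_num H I) / real (card (verts H)) * b_coeff H I"

definition successive_ordering_poly :: "('a, 'b) pre_digraph \<Rightarrow> real poly" where
  "successive_ordering_poly H = (\<Sum>I\<in>independent_sets H. monom (w_coeff H I) (card I))"

definition delete_verts :: "('a, 'b) pre_digraph \<Rightarrow> 'a set \<Rightarrow> ('a, 'b) pre_digraph" where
  "delete_verts G S = G \<restriction> (verts G - S)"

definition U_poly :: "('a, 'b) pre_digraph \<Rightarrow> 'a set \<Rightarrow> real poly" where
  "U_poly G S =
    (\<Sum>I\<in>{I \<in> independent_sets G. I \<inter> S \<noteq> {}}. monom (w_coeff G I) (card I))"

definition R_poly :: "('a, 'b) pre_digraph \<Rightarrow> 'a set \<Rightarrow> real poly" where
  "R_poly G S =
    (\<Sum>I\<in>independent_sets (delete_verts G S).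
       monom (w_coeff (delete_verts G S) I - w_coeff G I) (card I))"

definition delta_b :: "('a, 'b) pre_digraph \<Rightarrow> 'a set \<Rightarrow> 'a set \<Rightarrow> real" where
  "delta_b G S I = b_coeff (delete_verts G S) I - b_coeff G I"

end

theory Submission
  imports Defs
begin

text \<open>Deleting \<open>S\<close> leaves adjacency among the surviving vertices unchanged, so
  the independent sets of \<open>G'\<close> are those of \<open>G\<close> that miss
  \<open>S\<close>. Splitting the sum for \<open>G\<close> by whether \<open>I\<close> meets
  \<open>S\<close> gives \<open>U_poly\<close> plus a sum over the independent sets of
  \<open>G'\<close> with weights from \<open>G\<close>; \<open>R_poly\<close> is exactly the cost of
  replacing these weights by those of \<open>G'\<close>. For \<open>I\<close> missing
  \<open>S\<close>, the closed neighbourhood loses just its part in \<open>S\<close>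
  (\<open>closed_nbhd_delete_verts\<close>), which yields all the cardinality formulas. Part (iii)
  comes from subtracting the recursions for \<open>b_coeff\<close> in the two graphs after clearing
  denominators (\<open>delta_b_recurrence\<close>). Uniqueness is induction on \<open>I\<close>,
  since the factor in front of the unknown is positive.\<close>

lemma verts_delete_verts: "verts (delete_verts G S) = verts G - S"
  by (simp add: delete_verts_def)

lemma dominates_delete_verts_iff:
  "u \<rightarrow>\<^bsub>delete_verts G S\<^esub> v \<longleftrightarrow> u \<rightarrow>\<^bsub>G\<^esub> v \<and> u \<in> verts G - S \<and> v \<in> verts G - S"
  by (auto simp: delete_verts_def induce_subgraph_def arcs_ends_def arc_to_ends_def)

lemma independent_sets_delete_verts:
  "independent_sets (delete_verts G S) = {I \<in> independent_sets G. I \<inter> S = {}}"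
  unfolding independent_sets_def
  by (auto simp: verts_delete_verts dominates_delete_verts_iff; blast)

lemma independent_setsD: "I \<in> independent_sets H \<Longrightarrow> I \<subseteq> verts H"
  by (simp add: independent_sets_def)

lemma independent_sets_subset:
  "I \<in> independent_sets H \<Longrightarrow> J \<subseteq> I \<Longrightarrow> J \<in> independent_sets H"
  unfolding independent_sets_def by blast

lemma finite_independent_sets: "finite (verts H) \<Longrightarrow> finite (independent_sets H)"
  by (rule finite_subset[of _ "Pow (verts H)"]) (auto simp: independent_sets_def)

lemma closed_nbhd_subset_verts: "I \<subseteq> verts H \<Longrightarrow> closed_nbhd H I \<subseteq> verts H"
  by (auto simp: closed_nbhd_def nbhd_def)

text \<open>As \<open>I\<close> avoids \<open>S\<close>, every arc leaving \<open>I\<close> survives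
  unless its head lies in \<open>S\<close>.\<close>

lemma closed_nbhd_delete_verts:
  assumes "I \<subseteq> verts G - S"
  shows "closed_nbhd (delete_verts G S) I = closed_nbhd G I - S"
  using assms
  by (auto simp: closed_nbhd_def nbhd_def verts_delete_verts dominates_delete_verts_iff)

text \<open>Stated as a sum, so that no truncated subtraction on naturals arises.\<close>

lemma card_closed_nbhd_delete_verts:
  assumes "finite (verts G)" "I \<subseteq> verts G - S"
  shows "card (closed_nbhd G I) =
    card (closed_nbhd (delete_verts G S) I) + card (closed_nbhd G I \<inter> S)"
proof -
  have "finite (closed_nbhd G I)"
    using assms by (intro finite_subset[OF closed_nbhd_subset_verts]) auto
  then show ?thesis
    using card_Int_Diff[of "closed_nbhd G I" S] assms(2)
    by (simp add: closed_nbhd_delete_verts)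
qed

lemma a_num_add_card_closed_nbhd:
  assumes "finite (verts H)" "I \<subseteq> verts H"
  shows "a_num H I + card (closed_nbhd H I) = card (verts H)"
proof -
  have "closed_nbhd H I \<subseteq> verts H"
    using assms(2) by (rule closed_nbhd_subset_verts)
  then show ?thesis
    unfolding a_num_def using assms(1)
    by (metis card_Diff_subset card_mono finite_subset le_add_diff_inverse2)
qed

lemma card_closed_nbhd_pos:
  assumes "finite (verts H)" "I \<subseteq> verts H" "I \<noteq> {}"
  shows "card (closed_nbhd H I) > 0"
  using assms finite_subset[OF closed_nbhd_subset_verts]
  by (auto simp: card_gt_0_iff closed_nbhd_def)

text \<open>With the denominator cleared, the recursions for \<open>G\<close> and \<open>G'\<close>
  are linear and can be subtracted although their denominators differ.\<close>

lemma card_closed_nbhd_mult_b_coeff: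
  assumes "finite (verts H)" "I \<subseteq> verts H" "I \<noteq> {}"
  shows "real (card (closed_nbhd H I)) * b_coeff H I = (\<Sum>v\<in>I. b_coeff H (I - {v}))"
  using card_closed_nbhd_pos[OF assms] by (simp add: b_coeff_closed_nbhd[OF assms])

lemma delta_b_empty: "delta_b G S {} = 0"
  by (simp add: delta_b_def b_coeff_empty)

lemma delta_b_recurrence:
  assumes "finite (verts G)" "I \<subseteq> verts G - S" "I \<noteq> {}"
  shows "real (card (closed_nbhd (delete_verts G S) I)) * delta_b G S I =
    (\<Sum>v\<in>I. delta_b G S (I - {v})) + real (card (closed_nbhd G I \<inter> S)) * b_coeff G I"
proof -
  let ?G' = "delete_verts G S"
  have "real (card (closed_nbhd ?G' I)) * b_coeff ?G' I = (\<Sum>v\<in>I. b_coeff ?G' (I - {v}))"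
    using assms by (intro card_closed_nbhd_mult_b_coeff) (auto simp: verts_delete_verts)
  moreover have "real (card (closed_nbhd G I)) * b_coeff G I = (\<Sum>v\<in>I. b_coeff G (I - {v}))"
    using assms by (intro card_closed_nbhd_mult_b_coeff) auto
  \<comment> \<open>Splitting the factor for \<open>G\<close> leaves a common factor for
    \<open>G'\<close> on both \<open>b_coeff\<close> values; the remainder is the inhomogeneous term
    of the recurrence.\<close>
  moreover have "real (card (closed_nbhd G I)) =
      real (card (closed_nbhd ?G' I)) + real (card (closed_nbhd G I \<inter> S))"
    using card_closed_nbhd_delete_verts[OF assms(1,2)] by simp
  ultimately show ?thesis
    by (simp add: delta_b_def sum_subtractf algebra_simps)
qed

text \<open>The inhomogeneous term \<open>c\<close> is arbitrary: only the positive leading factor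
  and the descent to the sets \<open>I - {v}\<close>, again independent, matter.\<close>

lemma independent_set_recurrence_unique:
  fixes D E :: "'a set \<Rightarrow> real"
  assumes "finite (verts H)" and "D {} = E {}"
    and D: "\<And>I. I \<in> independent_sets H \<Longrightarrow> I \<noteq> {} \<Longrightarrow>
      real (card (closed_nbhd H I)) * D I = (\<Sum>v\<in>I. D (I - {v})) + c I"
    and E: "\<And>I. I \<in> independent_sets H \<Longrightarrow> I \<noteq> {} \<Longrightarrow>
      real (card (closed_nbhd H I)) * E I = (\<Sum>v\<in>I. E (I - {v})) + c I"
    and "I \<in> independent_sets H"
  shows "D I = E I"
proof -
  have "finite I"
    using assms(1,5) by (blast intro: finite_subset dest: independent_setsD)
  then show ?thesis
    using assms(5)
  proof (induction I rule: finite_psubset_induct)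
    case (psubset I)
    show ?case
    proof (cases "I = {}")
      case True
      then show ?thesis using assms(2) by simp
    next
      case False
      have "D (I - {v}) = E (I - {v})" if "v \<in> I" for v
        using that psubset by (blast intro: independent_sets_subset)
      then have "real (card (closed_nbhd H I)) * D I = real (card (closed_nbhd H I)) * E I"
        using D[OF psubset.prems False] E[OF psubset.prems False] by simp
      moreover have "card (closed_nbhd H I) > 0"
        using assms(1) independent_setsD[OF psubset.prems] False by (rule card_closed_nbhd_pos)
      ultimately show ?thesis by simp
    qed
  qed
qed

lemma successive_ordering_poly_delete_verts:
  assumes "finite (verts G)"
  shows "successive_ordering_poly G =
    successive_ordering_poly (delete_verts G S) - R_poly G S + U_poly G S"
proof -
  let ?m = "\<lambda>I. monom (w_coeff G I) (card I)"
  let ?G' = "delete_verts G S"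
  have split: "independent_sets G =
      independent_sets ?G' \<union> {I \<in> independent_sets G. I \<inter> S \<noteq> {}}"
    by (auto simp: independent_sets_delete_verts)
  have "successive_ordering_poly G = (\<Sum>I\<in>independent_sets ?G'. ?m I) + U_poly G S"
    unfolding successive_ordering_poly_def U_poly_def
    using finite_independent_sets[OF assms]
    by (subst split, subst sum.union_disjoint) (auto simp: independent_sets_delete_verts)
  \<comment> \<open>The weights of \<open>?G'\<close> cancel term by term whatever their values, so
    the convention 0 / 0 = 0 does no harm when \<open>S\<close> is the whole vertex set.\<close>
  moreover have "successive_ordering_poly ?G' - R_poly G S = (\<Sum>I\<in>independent_sets ?G'. ?m I)"
    by (simp add: successive_ordering_poly_def R_poly_def flip: sum_subtractf diff_monom)
  ultimately show ?thesis by simp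
qed

text \<open>Part (ii) is stated over the integers to make its subtractions genuine. The last
  conjunct expresses unique determination: any solution \<open>D\<close> of the recurrence that
  vanishes at the empty set agrees with \<open>delta_b\<close> on all independent sets of
  \<open>G'\<close>.\<close>

theorem theorem5p4:
  fixes G G' :: "('a, 'b) pre_digraph" and S :: "'a set"
  assumes "graph G"
    and "S \<subseteq> verts G"
    and "G' = delete_verts G S"
  shows "(successive_ordering_poly G = successive_ordering_poly G' - R_poly G S + U_poly G S) \<and>
    (independent_sets G' = {I \<in> independent_sets G. I \<inter> S = {}}) \<and>
    (\<forall>I\<in>independent_sets G'.
           int (card (closed_nbhd G' I)) =
             int (card (closed_nbhd G I)) - int (card (closed_nbhd G I \<inter> S)) \<and>
           int (a_num G' I) =
             int (a_num G I) - (int (card S) - int (card (closed_nbhd G I \<inter> S)))) \<and>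
    (delta_b G S {} = 0) \<and>
    (\<forall>I\<in>independent_sets G'. I \<noteq> {} \<longrightarrow>
           real (card (closed_nbhd G' I)) * delta_b G S I =
             (\<Sum>v\<in>I. delta_b G S (I - {v})) + real (card (closed_nbhd G I \<inter> S)) * b_coeff G I) \<and>
    (\<forall>D :: 'a set \<Rightarrow> real.
           D {} = 0 \<and>
           (\<forall>I\<in>independent_sets G'. I \<noteq> {} \<longrightarrow>
             real (card (closed_nbhd G' I)) * D I =
               (\<Sum>v\<in>I. D (I - {v})) + real (card (closed_nbhd G I \<inter> S)) * b_coeff G I) \<longrightarrow>
           (\<forall>I\<in>independent_sets G'. D I = delta_b G S I))"
proof -
  interpret graph G by fact
  have fin: "finite (verts G)" by simp
  have sub: "I \<subseteq> verts G - S" if "I \<in> independent_sets G'" for I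
    using independent_setsD[OF that] by (simp add: assms(3) verts_delete_verts)
  have card_nbhd: "card (closed_nbhd G I) = card (closed_nbhd G' I) + card (closed_nbhd G I \<inter> S)"
    if "I \<in> independent_sets G'" for I
    using card_closed_nbhd_delete_verts[OF fin sub[OF that]] by (simp add: assms(3))
  have card_verts: "card (verts G) = card (verts G') + card S"
    using card_Int_Diff[OF fin, of S] assms(2)
    by (simp add: assms(3) verts_delete_verts Int_absorb1)
  have a_num: "int (a_num G' I) =
      int (a_num G I) - (int (card S) - int (card (closed_nbhd G I \<inter> S)))"
    if I: "I \<in> independent_sets G'" for I
  proof -
    have "a_num G I + card (closed_nbhd G I) = card (verts G)"
      using fin sub[OF I] by (intro a_num_add_card_closed_nbhd) auto
    moreover have "a_num G' I + card (closed_nbhd G' I) = card (verts G')"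
      using fin independent_setsD[OF I]
      by (intro a_num_add_card_closed_nbhd) (auto simp: assms(3) verts_delete_verts)
    ultimately show ?thesis
      using card_nbhd[OF I] card_verts by linarith
  qed
  have recurrence: "real (card (closed_nbhd G' I)) * delta_b G S I =
      (\<Sum>v\<in>I. delta_b G S (I - {v})) + real (card (closed_nbhd G I \<inter> S)) * b_coeff G I"
    if "I \<in> independent_sets G'" "I \<noteq> {}" for I
    using delta_b_recurrence[OF fin sub[OF that(1)] that(2)] by (simp add: assms(3))
  have unique: "D I = delta_b G S I"
    if "D {} = 0" "\<forall>I\<in>independent_sets G'. I \<noteq> {} \<longrightarrow>
        real (card (closed_nbhd G' I)) * D I =
          (\<Sum>v\<in>I. D (I - {v})) + real (card (closed_nbhd G I \<inter> S)) * b_coeff G I"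
      "I \<in> independent_sets G'" for D I
  \<comment> \<open>Here \<open>recurrence\<close> fixes the second solution as
    \<open>delta_b G S\<close> and thereby also the term \<open>c\<close>.\<close>
  proof (rule independent_set_recurrence_unique[OF _ _ _ recurrence that(3)])
    show "finite (verts G')" by (simp add: assms(3) verts_delete_verts)
  qed (use that in \<open>simp_all add: delta_b_empty\<close>)
  show ?thesis
    using successive_ordering_poly_delete_verts[OF fin, of S]
      independent_sets_delete_verts[of G S] card_nbhd a_num delta_b_empty recurrence unique
    by (intro conjI ballI allI impI) (simp_all add: assms(3))
qed

end
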